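(* A poset $P\in\mathbb{P}\mathrm{oset}$ is an adjoint monoid (i.e. admits an adjoint monoid structure $(P,\mu,\eta)$) if and only if it is a meet-semilattice, in which case $\eta=\mathrm{true}$ (the top element) and $\mu=\wedge$ (binary meet).
   Context: $\mathbb{P}\mathrm{oset}$ is the po-category (poset-enriched category) of posets and monotone maps with pointwise order, symmetric monoidal under cartesian product with unit the terminal poset $1$. An adjoint (commutative) monoid in a symmetric monoidal po-category is a commutative monoid object $(c,\mu\colon c\otimes c\to c,\eta\colon I\to c)$ such that $\mu$ and $\eta$ are right adjoints (a morphism $R\colon d\to c$ is a right adjoint if there is $L\colon c\to d$ with $\mathrm{id}_c\le L;R$ and $R;L\le\mathrm{id}_d$, where $f;g$ means first $f$, then $g$). A meet-semilattice is a poset with a top element, denoted $\mathrm{true}$, and binary meets. *)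

theory Defs
  imports "HOL-Algebra.Lattice" "HOL-Library.FuncSet"
begin

text \<open>
  The po-category of posets. Objects are the partially ordered \<^typ>\<open>'a gorder\<close>s of HOL-Algebra
  (carrier-based, so the empty poset is an object). Morphisms are extensional functions (equal to
  \<^const>\<open>undefined\<close> outside the carrier of the domain), so that equality of morphisms is equality
  in HOL. Tensoring changes the type of the underlying set; this is why the po-category is given
  by polymorphic constants rather than as an instance of an abstract structure with one type of
  objects.
\<close>

definition poset_hom :: "'a gorder \<Rightarrow> 'b gorder \<Rightarrow> ('a \<Rightarrow> 'b) set" where
  "poset_hom A B = {f \<in> carrier A \<rightarrow>\<^sub>E carrier B. isotone A B f}"

definition poset_hom_le :: "'a gorder \<Rightarrow> 'b gorder \<Rightarrow> ('a \<Rightarrow> 'b) \<Rightarrow> ('a \<Rightarrow> 'b) \<Rightarrow> bool" where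
  "poset_hom_le A B f g \<longleftrightarrow> (\<forall>x\<in>carrier A. f x \<sqsubseteq>\<^bsub>B\<^esub> g x)"

definition poset_id :: "'a gorder \<Rightarrow> 'a \<Rightarrow> 'a" where
  "poset_id A = (\<lambda>x\<in>carrier A. x)"

text \<open>Composition is in diagrammatic order: first \<open>f\<close>, then \<open>g\<close>, with \<open>A\<close> the domain of \<open>f\<close>.\<close>

definition poset_seq :: "'a gorder \<Rightarrow> ('a \<Rightarrow> 'b) \<Rightarrow> ('b \<Rightarrow> 'c) \<Rightarrow> ('a \<Rightarrow> 'c)" where
  "poset_seq A f g = compose (carrier A) g f"

definition poset_unit :: "unit gorder" where
  "poset_unit = \<lparr>carrier = UNIV, eq = (=), le = (=)\<rparr>"

definition poset_prod :: "'a gorder \<Rightarrow> 'b gorder \<Rightarrow> ('a \<times> 'b) gorder" where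
  "poset_prod A B =
     \<lparr>carrier = carrier A \<times> carrier B,
      eq = (=),
      le = (\<lambda>p q. fst p \<sqsubseteq>\<^bsub>A\<^esub> fst q \<and> snd p \<sqsubseteq>\<^bsub>B\<^esub> snd q)\<rparr>"

definition poset_tensor ::
  "'a gorder \<Rightarrow> 'b gorder \<Rightarrow> ('a \<Rightarrow> 'c) \<Rightarrow> ('b \<Rightarrow> 'd) \<Rightarrow> ('a \<times> 'b \<Rightarrow> 'c \<times> 'd)" where
  "poset_tensor A B f g = (\<lambda>(x, y)\<in>carrier (poset_prod A B). (f x, g y))"

definition poset_assoc ::
  "'a gorder \<Rightarrow> 'b gorder \<Rightarrow> 'c gorder \<Rightarrow> (('a \<times> 'b) \<times> 'c \<Rightarrow> 'a \<times> 'b \<times> 'c)" where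
  "poset_assoc A B C = (\<lambda>((x, y), z)\<in>carrier (poset_prod (poset_prod A B) C). (x, y, z))"

definition poset_lunit :: "'a gorder \<Rightarrow> (unit \<times> 'a \<Rightarrow> 'a)" where
  "poset_lunit A = (\<lambda>(u, x)\<in>carrier (poset_prod poset_unit A). x)"

definition poset_runit :: "'a gorder \<Rightarrow> ('a \<times> unit \<Rightarrow> 'a)" where
  "poset_runit A = (\<lambda>(x, u)\<in>carrier (poset_prod A poset_unit). x)"

definition poset_swap :: "'a gorder \<Rightarrow> 'b gorder \<Rightarrow> ('a \<times> 'b \<Rightarrow> 'b \<times> 'a)" where
  "poset_swap A B = (\<lambda>(x, y)\<in>carrier (poset_prod A B). (y, x))"

text \<open>The morphism \<open>R\<close> from \<open>D\<close> to \<open>C\<close> has a left adjoint in the po-category.\<close>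

definition poset_right_adjoint :: "'d gorder \<Rightarrow> 'c gorder \<Rightarrow> ('d \<Rightarrow> 'c) \<Rightarrow> bool" where
  "poset_right_adjoint D C R \<longleftrightarrow>
     R \<in> poset_hom D C \<and>
     (\<exists>L\<in>poset_hom C D.
        poset_hom_le C C (poset_id C) (poset_seq C L R) \<and>
        poset_hom_le D D (poset_seq D R L) (poset_id D))"

locale poset_comm_monoid =
  fixes P :: "'a gorder" and \<mu> :: "'a \<times> 'a \<Rightarrow> 'a" and \<eta> :: "unit \<Rightarrow> 'a"
  assumes poset: "partial_order P"
    and mult_hom: "\<mu> \<in> poset_hom (poset_prod P P) P"
    and unit_hom: "\<eta> \<in> poset_hom poset_unit P"
    and assoc:
      "poset_seq (poset_prod (poset_prod P P) P)
         (poset_tensor (poset_prod P P) P \<mu> (poset_id P)) \<mu> =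
       poset_seq (poset_prod (poset_prod P P) P)
         (poset_assoc P P P)
         (poset_seq (poset_prod P (poset_prod P P))
            (poset_tensor P (poset_prod P P) (poset_id P) \<mu>) \<mu>)"
    and left_unit:
      "poset_seq (poset_prod poset_unit P) (poset_tensor poset_unit P \<eta> (poset_id P)) \<mu> =
       poset_lunit P"
    and right_unit:
      "poset_seq (poset_prod P poset_unit) (poset_tensor P poset_unit (poset_id P) \<eta>) \<mu> =
       poset_runit P"
    and comm: "poset_seq (poset_prod P P) (poset_swap P P) \<mu> = \<mu>"

locale poset_adjoint_monoid = poset_comm_monoid +
  assumes mult_right_adjoint: "poset_right_adjoint (poset_prod P P) P \<mu>"
    and unit_right_adjoint: "poset_right_adjoint poset_unit P \<eta>"

locale meet_semilattice = lower_semilattice + weak_partial_order_top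

text \<open>The top element and the binary meet of HOL-Algebra, as functions of the types of \<open>\<eta>\<close>, \<open>\<mu>\<close>.\<close>

definition poset_true :: "'a gorder \<Rightarrow> unit \<Rightarrow> 'a" where
  "poset_true P = (\<lambda>_\<in>carrier poset_unit. \<top>\<^bsub>P\<^esub>)"

definition poset_meet :: "'a gorder \<Rightarrow> 'a \<times> 'a \<Rightarrow> 'a" where
  "poset_meet P = (\<lambda>(x, y)\<in>carrier (poset_prod P P). x \<sqinter>\<^bsub>P\<^esub> y)"

end

(*
  The left adjoint of the unit is the map P -> 1, so the adjunction says precisely that the value
  of the unit is the top element t. Monotonicity and the unit laws then give
  \<mu>(x,y) \<sqsubseteq> \<mu>(x,t) = x and \<mu>(x,y) \<sqsubseteq> \<mu>(t,y) = y. Let c \<mapsto> (l c, r c) be the left adjoint of \<mu>.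
  The counit at (c,t) and at (t,c) gives l c \<sqsubseteq> c and r c \<sqsubseteq> c, so the unit of the adjunction gives
  c \<sqsubseteq> \<mu>(l c, r c) \<sqsubseteq> \<mu>(c,c); hence every common lower bound c of x and y satisfies c \<sqsubseteq> \<mu>(x,y).
  Conversely, the diagonal is left adjoint to the binary meet.
*)
theory Submission
  imports Defs
begin

lemma carrier_poset_unit [simp]: "carrier poset_unit = UNIV"
  and le_poset_unit [simp]: "u \<sqsubseteq>\<^bsub>poset_unit\<^esub> v"
  by (simp_all add: poset_unit_def)

lemma carrier_poset_prod [simp]: "carrier (poset_prod A B) = carrier A \<times> carrier B"
  and le_poset_prod [simp]:
    "p \<sqsubseteq>\<^bsub>poset_prod A B\<^esub> q \<longleftrightarrow> fst p \<sqsubseteq>\<^bsub>A\<^esub> fst q \<and> snd p \<sqsubseteq>\<^bsub>B\<^esub> snd q"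
  by (simp_all add: poset_prod_def)

lemma partial_order_poset_unit: "partial_order poset_unit"
  by unfold_locales (auto simp: poset_unit_def)

lemma partial_order_poset_prod:
  assumes "partial_order A" "partial_order B"
  shows "partial_order (poset_prod A B)"
proof -
  interpret A: partial_order A by fact
  interpret B: partial_order B by fact
  show ?thesis
    by unfold_locales
      (auto simp: poset_prod_def intro: A.le_trans B.le_trans A.le_antisym B.le_antisym)
qed

text \<open>\<open>isotone\<close> includes that source and target are weak partial orders, which is
  why the rule asks for both orders besides monotonicity.\<close>

lemma poset_homI:
  assumes "partial_order A" "partial_order B"
    and "f \<in> extensional (carrier A)"
    and "\<And>x. x \<in> carrier A \<Longrightarrow> f x \<in> carrier B"
    and "\<And>x y. x \<in> carrier A \<Longrightarrow> y \<in> carrier A \<Longrightarrow> x \<sqsubseteq>\<^bsub>A\<^esub> y \<Longrightarrow> f x \<sqsubseteq>\<^bsub>B\<^esub> f y"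
  shows "f \<in> poset_hom A B"
  using assms by (auto simp: poset_hom_def isotone_def PiE_def partial_order_def)

lemma poset_hom_closed: "f \<in> poset_hom A B \<Longrightarrow> x \<in> carrier A \<Longrightarrow> f x \<in> carrier B"
  by (auto simp: poset_hom_def)

lemma poset_hom_mono:
  "f \<in> poset_hom A B \<Longrightarrow> x \<in> carrier A \<Longrightarrow> y \<in> carrier A \<Longrightarrow> x \<sqsubseteq>\<^bsub>A\<^esub> y \<Longrightarrow> f x \<sqsubseteq>\<^bsub>B\<^esub> f y"
  by (auto simp: poset_hom_def isotone_def)

lemma poset_hom_extensional: "f \<in> poset_hom A B \<Longrightarrow> f \<in> extensional (carrier A)"
  by (auto simp: poset_hom_def PiE_def)

lemma poset_seq_apply [simp]: "x \<in> carrier A \<Longrightarrow> poset_seq A f g x = g (f x)"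
  by (simp add: poset_seq_def compose_def)

text \<open>Identities and composites are evaluated at points of the carriers, which turns the
  adjunction into a unit and a counit inequality between elements.\<close>

lemma poset_right_adjoint_iff:
  "poset_right_adjoint D C R \<longleftrightarrow>
     R \<in> poset_hom D C \<and>
     (\<exists>L\<in>poset_hom C D. (\<forall>c\<in>carrier C. c \<sqsubseteq>\<^bsub>C\<^esub> R (L c)) \<and> (\<forall>d\<in>carrier D. L (R d) \<sqsubseteq>\<^bsub>D\<^esub> d))"
  by (simp add: poset_right_adjoint_def poset_hom_le_def poset_id_def)

context poset_comm_monoid
begin

interpretation partial_order P by (rule poset)

lemma mult_closed [simp]: "x \<in> carrier P \<Longrightarrow> y \<in> carrier P \<Longrightarrow> \<mu> (x, y) \<in> carrier P"
  using poset_hom_closed[OF mult_hom] by simp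

lemma unit_closed [simp]: "\<eta> u \<in> carrier P"
  using poset_hom_closed[OF unit_hom] by simp

lemma mult_mono:
  assumes "x \<sqsubseteq>\<^bsub>P\<^esub> x'" "y \<sqsubseteq>\<^bsub>P\<^esub> y'"
    and "x \<in> carrier P" "x' \<in> carrier P" "y \<in> carrier P" "y' \<in> carrier P"
  shows "\<mu> (x, y) \<sqsubseteq>\<^bsub>P\<^esub> \<mu> (x', y')"
  using poset_hom_mono[OF mult_hom] assms by simp

lemma mult_unit_left: "x \<in> carrier P \<Longrightarrow> \<mu> (\<eta> u, x) = x"
  using fun_cong[OF left_unit, of "(u, x)"]
  by (simp add: poset_tensor_def poset_lunit_def poset_id_def)

lemma mult_unit_right: "x \<in> carrier P \<Longrightarrow> \<mu> (x, \<eta> u) = x"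
  using fun_cong[OF right_unit, of "(x, u)"]
  by (simp add: poset_tensor_def poset_runit_def poset_id_def)

end

context poset_adjoint_monoid
begin

interpretation partial_order P by (rule poset)

lemma unit_greatest: "greatest P (\<eta> u) (carrier P)"
  using unit_right_adjoint by (auto simp: poset_right_adjoint_iff greatest_def)

lemma le_unit: "x \<in> carrier P \<Longrightarrow> x \<sqsubseteq>\<^bsub>P\<^esub> \<eta> u"
  using unit_greatest by (simp add: greatest_def)

text \<open>Since \<open>\<eta> ()\<close> is the greatest element, \<open>y\<close> can be enlarged
  to it, and the right unit law then collapses the product to \<open>x\<close>.\<close>

lemma mult_le_left:
  assumes "x \<in> carrier P" "y \<in> carrier P"
  shows "\<mu> (x, y) \<sqsubseteq>\<^bsub>P\<^esub> x"
  using mult_mono[of x x y "\<eta> ()"] assms by (simp add: le_unit mult_unit_right)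

lemma mult_le_right:
  assumes "x \<in> carrier P" "y \<in> carrier P"
  shows "\<mu> (x, y) \<sqsubseteq>\<^bsub>P\<^esub> y"
  using mult_mono[of x "\<eta> ()" y y] assms by (simp add: le_unit mult_unit_left)

text \<open>Together with \<open>mult_le_left\<close> this makes \<open>\<mu>\<close> idempotent; it
  is the only fact drawn from the left adjoint of \<open>\<mu>\<close>.\<close>

lemma le_mult_self:
  assumes c: "c \<in> carrier P"
  shows "c \<sqsubseteq>\<^bsub>P\<^esub> \<mu> (c, c)"
proof -
  obtain L where L: "L \<in> poset_hom P (poset_prod P P)"
    and unit: "\<And>x. x \<in> carrier P \<Longrightarrow> x \<sqsubseteq>\<^bsub>P\<^esub> \<mu> (L x)"
    and counit: "\<And>p. p \<in> carrier P \<times> carrier P \<Longrightarrow>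
      fst (L (\<mu> p)) \<sqsubseteq>\<^bsub>P\<^esub> fst p \<and> snd (L (\<mu> p)) \<sqsubseteq>\<^bsub>P\<^esub> snd p"
    using mult_right_adjoint by (auto simp: poset_right_adjoint_iff)
  obtain l r where lr: "L c = (l, r)" by (cases "L c")
  have [simp]: "l \<in> carrier P" "r \<in> carrier P"
    using poset_hom_closed[OF L c] lr by simp_all
  \<comment> \<open>By the right unit law \<open>\<mu>\<close> sends \<open>(c, \<eta> ())\<close>
    to \<open>c\<close>, so the counit there compares \<open>L c\<close> itself with this pair; its
    first component is the bound on \<open>l\<close>.\<close>
  have "l \<sqsubseteq>\<^bsub>P\<^esub> c" using counit[of "(c, \<eta> ())"] c lr by (simp add: mult_unit_right)
  moreover have "r \<sqsubseteq>\<^bsub>P\<^esub> c" using counit[of "(\<eta> (), c)"] c lr by (simp add: mult_unit_left)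
  ultimately have "\<mu> (l, r) \<sqsubseteq>\<^bsub>P\<^esub> \<mu> (c, c)" using c by (intro mult_mono) auto
  moreover have "c \<sqsubseteq>\<^bsub>P\<^esub> \<mu> (l, r)" using unit[OF c] lr by simp
  ultimately show ?thesis using c by (blast intro: le_trans mult_closed \<open>l \<in> _\<close> \<open>r \<in> _\<close>)
qed

text \<open>Two copies of a lower bound \<open>c\<close> have a product above \<open>c\<close> and,
  by monotonicity, below \<open>\<mu> (x, y)\<close>.\<close>

lemma mult_glb:
  assumes "x \<in> carrier P" "y \<in> carrier P"
  shows "is_glb P (\<mu> (x, y)) {x, y}"
proof (rule greatest_LowerI)
  fix c assume "c \<in> Lower P {x, y}"
  then have c: "c \<in> carrier P" "c \<sqsubseteq>\<^bsub>P\<^esub> x" "c \<sqsubseteq>\<^bsub>P\<^esub> y"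
    using assms by (auto simp: Lower_def)
  then have "\<mu> (c, c) \<sqsubseteq>\<^bsub>P\<^esub> \<mu> (x, y)" using assms by (intro mult_mono)
  with le_mult_self[OF c(1)] show "c \<sqsubseteq>\<^bsub>P\<^esub> \<mu> (x, y)"
    using assms c(1) by (blast intro: le_trans mult_closed)
qed (use assms mult_le_left mult_le_right in auto)

lemma meet_semilattice: "meet_semilattice P"
proof unfold_locales
  show "\<exists>s. is_glb P s {x, y}" if "x \<in> carrier P" "y \<in> carrier P" for x y
    using mult_glb that by blast
  show "\<exists>x. greatest P x (carrier P)"
    using unit_greatest by blast
qed

lemma unit_eq_true: "\<eta> = poset_true P"
proof -
  interpret M: meet_semilattice P by (rule meet_semilattice)
  show ?thesis
    using greatest_unique[OF unit_greatest M.top_greatest] by (auto simp: poset_true_def)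
qed

lemma mult_eq_meet: "\<mu> = poset_meet P"
proof -
  interpret M: meet_semilattice P by (rule meet_semilattice)
  have "\<mu> (x, y) = x \<sqinter>\<^bsub>P\<^esub> y" if "x \<in> carrier P" "y \<in> carrier P" for x y
    \<comment> \<open>The library meet is a chosen greatest lower bound, so \<open>M.meetI\<close>
      asks for the equation with every such bound; antisymmetry makes them all equal.\<close>
    by (rule M.meetI) (rule greatest_unique mult_glb that | assumption)+
  then show ?thesis
    \<comment> \<open>Off the carrier both functions are \<open>undefined\<close>, so agreement on
      pairs of the carrier is equality.\<close>
    using poset_hom_extensional[OF mult_hom]
    by (auto simp: poset_meet_def fun_eq_iff extensional_def)
qed

end

context meet_semilattice
begin

text \<open>\<open>weak_meet_assoc\<close> holds up to the equivalence of the order structure, which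
  in a partial order is equality.\<close>

lemma meet_assoc:
  "x \<in> carrier L \<Longrightarrow> y \<in> carrier L \<Longrightarrow> z \<in> carrier L \<Longrightarrow> (x \<sqinter> y) \<sqinter> z = x \<sqinter> (y \<sqinter> z)"
  using weak_meet_assoc by (simp add: eq_is_equal)

lemma meet_mono:
  assumes "x \<sqsubseteq> x'" "y \<sqsubseteq> y'"
    and "x \<in> carrier L" "x' \<in> carrier L" "y \<in> carrier L" "y' \<in> carrier L"
  shows "x \<sqinter> y \<sqsubseteq> x' \<sqinter> y'"
  using assms by (meson le_trans meet_closed meet_le meet_left meet_right)

lemma meet_top_right: "x \<in> carrier L \<Longrightarrow> x \<sqinter> \<top> = x"
  by (meson le_antisym le_refl meet_closed meet_le meet_left top_closed top_higher)

lemma meet_top_left: "x \<in> carrier L \<Longrightarrow> \<top> \<sqinter> x = x"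
  using meet_top_right by (simp add: meet_comm)

end

context
  fixes P :: "'a gorder"
  assumes semilattice: "meet_semilattice P"
begin

interpretation meet_semilattice P by (rule semilattice)

lemma poset_meet_hom: "poset_meet P \<in> poset_hom (poset_prod P P) P"
  by (rule poset_homI)
    (auto simp: poset_meet_def partial_order_axioms intro: partial_order_poset_prod meet_mono)

lemma poset_true_hom: "poset_true P \<in> poset_hom poset_unit P"
  by (rule poset_homI)
    (auto simp: poset_true_def partial_order_axioms partial_order_poset_unit)

text \<open>For the diagonal the unit reads \<open>c \<sqsubseteq> c \<sqinter> c\<close>, and the
  counit says that a meet lies below both of its arguments.\<close>

lemma poset_meet_right_adjoint: "poset_right_adjoint (poset_prod P P) P (poset_meet P)"
proof -
  let ?\<Delta> = "\<lambda>x\<in>carrier P. (x, x)"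
  have "?\<Delta> \<in> poset_hom P (poset_prod P P)"
    by (rule poset_homI) (auto simp: partial_order_axioms intro: partial_order_poset_prod)
  moreover have "c \<sqsubseteq>\<^bsub>P\<^esub> poset_meet P (?\<Delta> c)" if "c \<in> carrier P" for c
    using that by (simp add: poset_meet_def meet_le)
  moreover have "?\<Delta> (poset_meet P p) \<sqsubseteq>\<^bsub>poset_prod P P\<^esub> p" if "p \<in> carrier P \<times> carrier P" for p
    using that by (auto simp: poset_meet_def meet_left meet_right)
  ultimately show ?thesis
    using poset_meet_hom unfolding poset_right_adjoint_iff carrier_poset_prod by blast
qed

lemma poset_true_right_adjoint: "poset_right_adjoint poset_unit P (poset_true P)"
proof -
  \<comment> \<open>For this left adjoint the unit says that every element is below the top, and the
    counit is trivial in the one-point poset.\<close>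
  have "(\<lambda>_\<in>carrier P. ()) \<in> poset_hom P poset_unit"
    by (rule poset_homI) (auto simp: partial_order_axioms partial_order_poset_unit)
  then show ?thesis
    using poset_true_hom by (auto simp: poset_right_adjoint_iff poset_true_def)
qed

lemma poset_adjoint_monoid_meet_true: "poset_adjoint_monoid P (poset_meet P) (poset_true P)"
proof -
  note defs = poset_meet_def poset_true_def poset_tensor_def poset_id_def
    poset_assoc_def poset_lunit_def poset_runit_def poset_swap_def
  have "poset_comm_monoid P (poset_meet P) (poset_true P)"
    \<comment> \<open>Unfolding \<open>restrict\<close> makes the monoid laws pointwise: off the
      carrier both sides are \<open>undefined\<close>, and on it they are the identities of meet and
      top.\<close>
    by (intro poset_comm_monoid.intro partial_order_axioms poset_meet_hom poset_true_hom;
        simp add: defs poset_seq_def compose_def restrict_def fun_eq_iff)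
      (auto simp: meet_assoc meet_top_left meet_top_right intro: meet_comm)
  then show ?thesis
    by (intro poset_adjoint_monoid.intro poset_adjoint_monoid_axioms.intro
        poset_meet_right_adjoint poset_true_right_adjoint)
qed

end

theorem proposition3p8:
  fixes P :: "'a gorder"
  assumes "partial_order P"
  shows "((\<exists>\<mu> \<eta>. poset_adjoint_monoid P \<mu> \<eta>) \<longleftrightarrow> meet_semilattice P) \<and>
    (\<forall>\<mu> \<eta>. poset_adjoint_monoid P \<mu> \<eta> \<longrightarrow> \<eta> = poset_true P \<and> \<mu> = poset_meet P)"
  using poset_adjoint_monoid_meet_true poset_adjoint_monoid.meet_semilattice
    poset_adjoint_monoid.unit_eq_true poset_adjoint_monoid.mult_eq_meet
  by blast

end
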